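(* Let $k>0$, $\ell>0$, $m>0$ be integers. The number $V_{k,\ell,m}=V(1^k2^\ell3^m)$ of vertices of the Gelfand--Zetlin polytope $GZ(1^k2^\ell3^m)$ is equal to the coefficient of $x^kz^m$ in the polynomial $$\frac{1-xz}{1+xz}\left((1+x)^{k+\ell+m}(1+z)^{k+\ell+m}-(x+z)^{k+\ell+m}\right).$$
   Context: Let $\lambda_1\le\dots\le\lambda_n$ be a non-decreasing finite sequence of integers (called a partition). The Gelfand--Zetlin polytope $GZ(\lambda)$ is the convex polytope in $\mathbb{R}^{n(n-1)/2}$ with coordinates $u_{i,j}$ ($1\le i\le n-1$, $1\le j\le n-i$) defined by the inequalities $u_{i-1,j}\le u_{i,j}\le u_{i-1,j+1}$ for all such $i,j$, where $u_{0,j}:=\lambda_j$. $1^k2^\ell3^m$ denotes the sequence consisting of $k$ copies of $1$, followed by $\ell$ copies of $2$, followed by $m$ copies of $3$. $V(p)$ denotes the number of vertices of $GZ(p)$. *)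

theory Defs
  imports "HOL-Analysis.Analysis" "HOL-Analysis.Finite_Function_Topology"
    "HOL-Computational_Algebra.Polynomial"
begin

text \<open>
  The dimension \<open>n (n - 1) / 2\<close> depends on the partition, so a point of the ambient space is a
  finitely supported function on \<open>nat \<times> nat\<close> vanishing off the index set \<open>gz_index n\<close>; this makes
  the library's notion of extreme point of a set in a real vector space available.
\<close>

definition gz_index :: "nat \<Rightarrow> (nat \<times> nat) set" where
  "gz_index n = {(i, j). 1 \<le> i \<and> i \<le> n - 1 \<and> 1 \<le> j \<and> j \<le> n - i}"

text \<open>Row \<open>0\<close> is the partition; list positions start at \<open>0\<close>, while \<open>\<lambda>\<^sub>j\<close> starts at \<open>j = 1\<close>.\<close>

definition gz_entry :: "int list \<Rightarrow> (nat \<times> nat \<Rightarrow>\<^sub>0 real) \<Rightarrow> nat \<Rightarrow> nat \<Rightarrow> real" where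
  "gz_entry p u i j =
     (if i = 0 then real_of_int (p ! (j - 1)) else Poly_Mapping.lookup u (i, j))"

definition GZ :: "int list \<Rightarrow> (nat \<times> nat \<Rightarrow>\<^sub>0 real) set" where
  "GZ p = {u. Poly_Mapping.keys u \<subseteq> gz_index (length p) \<and>
     (\<forall>(i, j) \<in> gz_index (length p).
        gz_entry p u (i - 1) j \<le> gz_entry p u i j \<and>
        gz_entry p u i j \<le> gz_entry p u (i - 1) (j + 1))}"

definition gz_vertex_count :: "int list \<Rightarrow> nat" where
  "gz_vertex_count p = card {v. v extreme_point_of (GZ p)}"

definition partition123 :: "nat \<Rightarrow> nat \<Rightarrow> nat \<Rightarrow> int list" where
  "partition123 k l m = replicate k 1 @ replicate l 2 @ replicate m 3"

lemma sorted_partition123: "sorted (partition123 k l m)"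
  by (auto simp: partition123_def sorted_append)

text \<open>
  Polynomials in \<open>x, z\<close> are elements of \<open>\<int>[z][x]\<close>: \<open>x\<close> is the outer and \<open>z\<close> the inner variable.
\<close>

definition poly_x :: "int poly poly" where "poly_x = [:0, 1:]"
definition poly_z :: "int poly poly" where "poly_z = [:[:0, 1:]:]"

definition coeff_xz :: "int poly poly \<Rightarrow> nat \<Rightarrow> nat \<Rightarrow> int" where
  "coeff_xz P a b = coeff (coeff P a) b"

lemma coeff_xz_monomial: "coeff_xz (poly_x ^ a * poly_z ^ b) c d = (if c = a \<and> d = b then 1 else 0)"
proof -
  have "poly_x ^ a = monom 1 a"
    by (simp add: poly_x_def monom_altdef)
  moreover have "poly_z ^ b = [:monom 1 b:]"
    by (simp add: poly_z_def poly_const_pow monom_altdef)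
  ultimately show ?thesis
    by (auto simp: coeff_xz_def mult.commute[of "monom 1 a"] smult_monom)
qed

definition gz_poly :: "nat \<Rightarrow> int poly poly" where
  "gz_poly N =
     ((1 - poly_x * poly_z) * ((1 + poly_x) ^ N * (1 + poly_z) ^ N - (poly_x + poly_z) ^ N)) div (1 + poly_x * poly_z)"

text \<open>The division is exact, so \<open>gz_poly N\<close> is the intended rational function.\<close>

lemma gz_poly_exact:
  "(1 + poly_x * poly_z) * gz_poly N = (1 - poly_x * poly_z) * ((1 + poly_x) ^ N * (1 + poly_z) ^ N - (poly_x + poly_z) ^ N)"
proof -
  have "((1 + poly_x) * (1 + poly_z) - (poly_x + poly_z)) dvd ((1 + poly_x) * (1 + poly_z)) ^ N - (poly_x + poly_z) ^ N"
    by (metis dvd_triv_left power_diff_sumr2)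
  moreover have "(1 + poly_x) * (1 + poly_z) - (poly_x + poly_z) = 1 + poly_x * poly_z"
    by (simp add: algebra_simps)
  ultimately have "1 + poly_x * poly_z dvd (1 + poly_x) ^ N * (1 + poly_z) ^ N - (poly_x + poly_z) ^ N"
    by (simp add: power_mult_distrib)
  then show ?thesis
    unfolding gz_poly_def by (intro dvd_mult_div_cancel dvd_mult)
qed

lemma one_plus_xz_nonzero: "1 + poly_x * poly_z \<noteq> 0"
  by (simp add: poly_x_def poly_z_def one_pCons)

end

theory Submission
  imports Defs
begin

text \<open>
  A point of the polytope is a vertex iff every entry equals one of its two neighbours in the row
  above. Hence the number of vertices for \<open>p\<close> is the sum of the numbers of vertices for the possible
  first rows \<open>q\<close>, where each \<open>q\<^sub>j\<close> is \<open>p\<^sub>j\<close> or \<open>p\<^sub>j\<^sub>+\<^sub>1\<close>. For \<open>1\<^sup>k2\<^sup>l3\<^sup>m\<close> with \<open>k, l, m > 0\<close> there are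
  four of them, and the recurrence is multiplication of the generating polynomial by
  \<open>(1 + x)(1 + z)\<close>. The polynomials \<open>f\<^sub>N\<close> of the theorem satisfy
  \<open>f\<^sub>N\<^sub>+\<^sub>1 = (1 + x)(1 + z) f\<^sub>N + (1 - x z)(x + z)\<^sup>N\<close>, and their coefficients at \<open>x\<^sup>kz\<^sup>m\<close> with \<open>k + m = N\<close>
  vanish by symmetry. The extra term therefore accounts exactly for the vertices of \<open>GZ(1\<^sup>k3\<^sup>m)\<close>,
  counted by the coefficients of \<open>(x + z)\<^sup>N\<close>.
\<close>

subsection \<open>Vertices\<close>

lemma mem_gz_index_iff: "(i, j) \<in> gz_index n \<longleftrightarrow> 1 \<le> i \<and> 1 \<le> j \<and> i + j \<le> n"
  by (auto simp: gz_index_def)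

lemma finite_gz_index: "finite (gz_index n)"
  by (rule finite_subset[of _ "{..n} \<times> {..n}"]) (auto simp: gz_index_def)

text \<open>Meant for finite \<open>A\<close>, where the cut-off function has finite support and
  \<open>lookup\<close> recovers it.\<close>

definition poly_mapping_on :: "'a set \<Rightarrow> ('a \<Rightarrow> 'b::zero) \<Rightarrow> 'a \<Rightarrow>\<^sub>0 'b" where
  "poly_mapping_on A f = Abs_poly_mapping (\<lambda>x. if x \<in> A then f x else 0)"

lemma lookup_poly_mapping_on:
  assumes "finite A"
  shows "Poly_Mapping.lookup (poly_mapping_on A f) x = (if x \<in> A then f x else 0)"
  unfolding poly_mapping_on_def
  by (subst lookup_Abs_poly_mapping) (auto intro: finite_subset[OF _ assms])

lemma keys_poly_mapping_on: "finite A \<Longrightarrow> Poly_Mapping.keys (poly_mapping_on A f) \<subseteq> A"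
  by (auto simp: in_keys_iff lookup_poly_mapping_on split: if_splits)

lemma lookup_scaleR_poly_mapping:
  "Poly_Mapping.lookup (c *\<^sub>R x) k = c *\<^sub>R Poly_Mapping.lookup x k"
  unfolding scaleR_poly_mapping_def
  by (subst lookup_Abs_poly_mapping) (auto intro: finite_subset[OF _ finite_keys[of x]] simp: in_keys_iff)

text \<open>Consecutive rows are numbered \<open>i\<close> and \<open>Suc i\<close> instead of
  \<open>i - 1\<close> and \<open>i\<close>, so that induction on rows can start at the fixed row
  0.\<close>

lemma GZ_iff:
  "u \<in> GZ p \<longleftrightarrow> Poly_Mapping.keys u \<subseteq> gz_index (length p) \<and>
     (\<forall>i j. 1 \<le> j \<longrightarrow> Suc i + j \<le> length p \<longrightarrow>
        gz_entry p u i j \<le> gz_entry p u (Suc i) j \<and> gz_entry p u (Suc i) j \<le> gz_entry p u i (Suc j))"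
proof -
  have "(\<forall>(i, j) \<in> gz_index (length p). P (i - 1) i j) \<longleftrightarrow>
        (\<forall>i j. 1 \<le> j \<longrightarrow> Suc i + j \<le> length p \<longrightarrow> P i (Suc i) j)" (is "?L = ?R")
    for P :: "nat \<Rightarrow> nat \<Rightarrow> nat \<Rightarrow> bool"
  proof
    assume ?L
    show ?R
    proof (intro allI impI)
      fix i j :: nat
      assume "1 \<le> j" "Suc i + j \<le> length p"
      then have "(Suc i, j) \<in> gz_index (length p)"
        by (simp add: mem_gz_index_iff)
      with \<open>?L\<close> show "P i (Suc i) j"
        by fastforce
    qed
  next
    assume R: ?R
    have "P (i - 1) i j" if "(i, j) \<in> gz_index (length p)" for i j
      using that R[rule_format, of j "i - 1"] by (auto simp: mem_gz_index_iff)
    then show ?L by blast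
  qed
  from this[of "\<lambda>i' i j. gz_entry p u i' j \<le> gz_entry p u i j \<and> gz_entry p u i j \<le> gz_entry p u i' (j + 1)"]
  show ?thesis
    by (simp add: GZ_def)
qed

lemma GZ_outside: "u \<in> GZ p \<Longrightarrow> x \<notin> gz_index (length p) \<Longrightarrow> Poly_Mapping.lookup u x = 0"
  by (auto simp: GZ_def in_keys_iff)

lemma GZ_D:
  assumes "u \<in> GZ p" "1 \<le> j" "Suc i + j \<le> length p"
  shows "gz_entry p u i j \<le> gz_entry p u (Suc i) j" "gz_entry p u (Suc i) j \<le> gz_entry p u i (Suc j)"
  using assms by (auto simp: GZ_iff)

text \<open>Consecutive entries of row \<open>Suc i\<close> are separated by the entry of row
  \<open>i\<close> that lies between them.\<close>

lemma gz_row_mono: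
  assumes u: "u \<in> GZ p" and "1 \<le> j" "j \<le> j'" "Suc i + j' \<le> length p"
  shows "gz_entry p u (Suc i) j \<le> gz_entry p u (Suc i) j'"
  using assms(3,4)
proof (induction j' rule: dec_induct)
  case (step n)
  have "gz_entry p u (Suc i) n \<le> gz_entry p u i (Suc n)"
    using step \<open>1 \<le> j\<close> by (intro GZ_D[OF u]) auto
  also have "\<dots> \<le> gz_entry p u (Suc i) (Suc n)"
    using step by (intro GZ_D[OF u]) auto
  finally show ?case
    using step by simp
qed simp

section \<open>Vertices as tight patterns\<close>

definition tight_patterns :: "int list \<Rightarrow> (nat \<times> nat \<Rightarrow>\<^sub>0 real) set" where
  "tight_patterns p = {u \<in> GZ p. \<forall>i j. 1 \<le> j \<longrightarrow> Suc i + j \<le> length p \<longrightarrow>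
     gz_entry p u (Suc i) j = gz_entry p u i j \<or> gz_entry p u (Suc i) j = gz_entry p u i (Suc j)}"

text \<open>Two deviations from \<open>c\<close> of the same sign cancel in a proper convex
  combination only if both are zero.\<close>

lemma convex_comb_eq_bound:
  fixes a b c t :: real
  assumes "(1 - t) * a + t * b = c" "0 < t" "t < 1" "a \<le> c \<and> b \<le> c \<or> c \<le> a \<and> c \<le> b"
  shows "a = c \<and> b = c"
proof -
  have eq: "(1 - t) * (a - c) + t * (b - c) = 0"
    using assms(1) by (simp add: algebra_simps)
  show ?thesis
    using assms(4)
  proof
    assume *: "a \<le> c \<and> b \<le> c"
    then have "(1 - t) * (a - c) \<le> 0" "t * (b - c) \<le> 0"
      using assms(2,3) by (auto simp: mult_le_0_iff)
    with eq have "(1 - t) * (a - c) = 0" "t * (b - c) = 0" by linarith+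
    then show ?thesis using assms(2,3) by auto
  next
    assume *: "c \<le> a \<and> c \<le> b"
    then have "(1 - t) * (a - c) \<ge> 0" "t * (b - c) \<ge> 0"
      using assms(2,3) by auto
    with eq have "(1 - t) * (a - c) = 0" "t * (b - c) = 0" by linarith+
    then show ?thesis using assms(2,3) by auto
  qed
qed

text \<open>If \<open>v\<close> lies between \<open>a\<close> and \<open>b\<close>, all three agree
  row by row: they share row 0, and once they agree in row \<open>i\<close>, the neighbour that a
  tight entry of \<open>v\<close> equals is a one-sided bound for the corresponding entries of
  \<open>a\<close> and \<open>b\<close>.\<close>

lemma tight_imp_extreme:
  assumes v: "v \<in> tight_patterns p"
  shows "v extreme_point_of GZ p"
  unfolding extreme_point_of_def
proof (intro conjI ballI notI)
  show "v \<in> GZ p"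
    using v by (simp add: tight_patterns_def)
next
  fix a b
  assume a: "a \<in> GZ p" and b: "b \<in> GZ p" and "v \<in> open_segment a b"
  then obtain t where "a \<noteq> b" and t: "0 < t" "t < 1" and veq: "v = (1 - t) *\<^sub>R a + t *\<^sub>R b"
    by (auto simp: in_segment)
  have comb: "(1 - t) * gz_entry p a i j + t * gz_entry p b i j = gz_entry p v i j" for i j
    by (simp add: gz_entry_def veq lookup_add lookup_scaleR_poly_mapping) (simp add: algebra_simps)
  have *: "gz_entry p a i j = gz_entry p v i j \<and> gz_entry p b i j = gz_entry p v i j"
    if "1 \<le> j" "i + j \<le> length p" for i j
    using that
  proof (induction i arbitrary: j)
    case 0
    then show ?case by (simp add: gz_entry_def)
  next
    case (Suc i)
    note IH = Suc.IH[of j] Suc.IH[of "Suc j"]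
    note bounds = GZ_D[OF a, of j i] GZ_D[OF b, of j i]
    have "gz_entry p v (Suc i) j = gz_entry p v i j \<or> gz_entry p v (Suc i) j = gz_entry p v i (Suc j)"
      using v Suc.prems by (simp add: tight_patterns_def)
    then show ?case
      using IH bounds Suc.prems by (intro convex_comb_eq_bound[OF comb t]) auto
  qed
  have "a = b"
  proof (rule poly_mapping_eqI)
    fix x :: "nat \<times> nat"
    obtain i j where x: "x = (i, j)" by fastforce
    show "Poly_Mapping.lookup a x = Poly_Mapping.lookup b x"
    proof (cases "(i, j) \<in> gz_index (length p)")
      case True
      then show ?thesis
        using *[of j i] by (auto simp: x gz_entry_def mem_gz_index_iff split: if_splits)
    next
      case False
      then show ?thesis
        using GZ_outside[OF a] GZ_outside[OF b] by (simp add: x)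
    qed
  qed
  with \<open>a \<noteq> b\<close> show False by simp
qed

lemma finite_gap:
  fixes f :: "'a \<Rightarrow> real"
  assumes "finite A"
  obtains \<epsilon> where "\<epsilon> > 0" "\<And>x. x \<in> A \<Longrightarrow> f x \<noteq> c \<Longrightarrow> \<epsilon> \<le> \<bar>f x - c\<bar>"
proof
  \<comment> \<open>The element 1 keeps the set nonempty when \<open>f\<close> is constantly
    \<open>c\<close> on \<open>A\<close>.\<close>
  let ?D = "insert 1 ((\<lambda>x. \<bar>f x - c\<bar>) ` {x \<in> A. f x \<noteq> c})"
  show "Min ?D > 0"
    using assms by (subst Min_gr_iff) auto
  show "Min ?D \<le> \<bar>f x - c\<bar>" if "x \<in> A" "f x \<noteq> c" for x
    using assms that by (intro Min_le) auto
qed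

text \<open>An entry strictly between its two neighbours in the row above can be moved up and down together
  with all equal entries in the rows below it; the monotonicity of its row ensures that no other
  entry of that row has the same value.\<close>

lemma extreme_imp_tight:
  assumes ext: "v extreme_point_of GZ p"
  shows "v \<in> tight_patterns p"
proof (rule ccontr)
  have v: "v \<in> GZ p"
    using ext by (simp add: extreme_point_of_def)
  assume "v \<notin> tight_patterns p"
  then obtain i j where ij: "1 \<le> j" "Suc i + j \<le> length p"
    and ne: "gz_entry p v (Suc i) j \<noteq> gz_entry p v i j" "gz_entry p v (Suc i) j \<noteq> gz_entry p v i (Suc j)"
    using v by (auto simp: tight_patterns_def)
  let ?e = "gz_entry p v"
  define c where "c = ?e (Suc i) j"
  have strict: "?e i j < c" "c < ?e i (Suc j)"
    using ne GZ_D[OF v ij] by (auto simp: c_def)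
  have row: "j' = j" if "1 \<le> j'" "Suc i + j' \<le> length p" "?e (Suc i) j' = c" for j'
  proof (rule ccontr)
    assume "j' \<noteq> j"
    then consider "j' < j" | "Suc j \<le> j'" by linarith
    then show False
    proof cases
      case 1
      then have "?e (Suc i) j' \<le> ?e (Suc i) (j - 1)"
        using that ij by (intro gz_row_mono[OF v]) auto
      also have "\<dots> \<le> ?e i (Suc (j - 1))"
        using 1 ij that by (intro GZ_D[OF v]) auto
      also have "\<dots> < c"
        using strict ij by simp
      finally show False using that by simp
    next
      case 2
      have "c < ?e i (Suc j)" by (rule strict)
      also have "\<dots> \<le> ?e (Suc i) (Suc j)"
        using 2 ij that by (intro GZ_D[OF v]) auto
      also have "\<dots> \<le> ?e (Suc i) j'"
        using 2 ij that by (intro gz_row_mono[OF v]) auto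
      finally show False using that by simp
    qed
  qed
  define S where "S = {(i', j') \<in> gz_index (length p). i < i' \<and> ?e i' j' = c}"
  have finS: "finite S"
    by (rule finite_subset[OF _ finite_gz_index[of "length p"]]) (auto simp: S_def)
  have S_iff: "(i', j') \<in> S \<longleftrightarrow> 1 \<le> j' \<and> i' + j' \<le> length p \<and> i < i' \<and> ?e i' j' = c" for i' j'
    by (auto simp: S_def mem_gz_index_iff)
  \<comment> \<open>The box contains all positions of the triangle; its further positions can only
    shrink \<epsilon>.\<close>
  obtain \<epsilon> where \<epsilon>: "\<epsilon> > 0"
    "\<And>x. x \<in> {..length p} \<times> {..length p} \<Longrightarrow> case_prod ?e x \<noteq> c \<Longrightarrow> \<epsilon> \<le> \<bar>case_prod ?e x - c\<bar>"
    by (rule finite_gap[of "{..length p} \<times> {..length p}" "case_prod ?e" c]) auto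
  have gap: "\<epsilon> \<le> \<bar>?e i' j' - c\<bar>" if "i' + j' \<le> length p" "?e i' j' \<noteq> c" for i' j'
    using \<epsilon>(2)[of "(i', j')"] that by auto
  define w where "w \<delta> = poly_mapping_on S (\<lambda>_. \<delta> :: real)" for \<delta>
  have entry: "gz_entry p (v + w \<delta>) i' j' = ?e i' j' + (if (i', j') \<in> S then \<delta> else 0)" for \<delta> i' j'
    by (auto simp: gz_entry_def w_def lookup_add lookup_poly_mapping_on[OF finS] S_iff)
  have moved: "v + w \<delta> \<in> GZ p" if \<delta>: "\<bar>\<delta>\<bar> \<le> \<epsilon>" for \<delta>
    unfolding GZ_iff
  proof (intro conjI allI impI)
    have "Poly_Mapping.keys (v + w \<delta>) \<subseteq> Poly_Mapping.keys v \<union> Poly_Mapping.keys (w \<delta>)"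
      by (rule keys_add)
    also have "\<dots> \<subseteq> gz_index (length p)"
      using v keys_poly_mapping_on[OF finS] by (auto simp: GZ_iff w_def S_def)
    finally show "Poly_Mapping.keys (v + w \<delta>) \<subseteq> gz_index (length p)" .
  next
    fix i' j' :: nat
    assume ij': "1 \<le> j'" "Suc i' + j' \<le> length p"
    \<comment> \<open>If exactly one of \<open>x\<close>, \<open>y\<close> is \<open>c\<close>, only
      that one can move, and the gap \<epsilon> absorbs the shift; if both are \<open>c\<close>,
      they move together.\<close>
    have sep: "x + (if P then \<delta> else 0) \<le> y + (if Q then \<delta> else 0)"
      if "x \<le> y" "P \<longrightarrow> x = c" "Q \<longrightarrow> y = c" "x \<noteq> c \<longrightarrow> \<epsilon> \<le> \<bar>x - c\<bar>" "y \<noteq> c \<longrightarrow> \<epsilon> \<le> \<bar>y - c\<bar>"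
        "x = c \<Longrightarrow> y = c \<Longrightarrow> P = Q" for x y P Q
      using that \<delta> by (cases "x = c"; cases "y = c") (auto split: if_splits)
    \<comment> \<open>Equal neighbours with value \<open>c\<close> could be separated only between
      rows \<open>i\<close> and \<open>Suc i\<close>. There \<open>row\<close> gives
      \<open>j' = j\<close>, but both upper neighbours of that entry differ from
      \<open>c\<close>.\<close>
    have eqS: "(Suc i', j') \<in> S \<longleftrightarrow> (i', j'') \<in> S"
      if "?e (Suc i') j' = c" "?e i' j'' = c" "j'' = j' \<or> j'' = Suc j'" for j''
    proof (cases "i' = i")
      case True
      then have False
        using row[of j'] that ij' strict by auto
      then show ?thesis ..
    next
      case False
      then show ?thesis
        using that ij' by (auto simp: S_iff)
    qed
    show "gz_entry p (v + w \<delta>) i' j' \<le> gz_entry p (v + w \<delta>) (Suc i') j'"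
      unfolding entry
      using GZ_D[OF v ij'] gap[of i' j'] gap[of "Suc i'" j'] ij' eqS[of j']
      by (intro sep) (auto simp: S_iff)
    show "gz_entry p (v + w \<delta>) (Suc i') j' \<le> gz_entry p (v + w \<delta>) i' (Suc j')"
      unfolding entry
      using GZ_D[OF v ij'] gap[of i' "Suc j'"] gap[of "Suc i'" j'] ij' eqS[of "Suc j'"]
      by (intro sep) (auto simp: S_iff)
  qed
  have "(Suc i, j) \<in> S"
    using ij by (simp add: S_iff c_def)
  then have "Poly_Mapping.lookup (v + w \<epsilon>) (Suc i, j) \<noteq> Poly_Mapping.lookup (v + w (- \<epsilon>)) (Suc i, j)"
    using \<epsilon>(1) by (simp add: w_def lookup_add lookup_poly_mapping_on[OF finS])
  then have "v + w \<epsilon> \<noteq> v + w (- \<epsilon>)" by metis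
  moreover have "v = midpoint (v + w \<epsilon>) (v + w (- \<epsilon>))"
    by (rule poly_mapping_eqI, simp only: midpoint_def lookup_scaleR_poly_mapping lookup_add)
      (simp add: w_def lookup_poly_mapping_on[OF finS])
  ultimately have "v \<in> open_segment (v + w \<epsilon>) (v + w (- \<epsilon>))"
    using midpoint_in_open_segment by metis
  then show False
    using ext moved[of \<epsilon>] moved[of "- \<epsilon>"] \<epsilon>(1) by (auto simp: extreme_point_of_def)
qed

lemma gz_vertex_count_eq: "gz_vertex_count p = card (tight_patterns p)"
proof -
  have "{v. v extreme_point_of GZ p} = tight_patterns p"
    using tight_imp_extreme extreme_imp_tight by blast
  then show ?thesis
    by (simp add: gz_vertex_count_def)
qed

subsection \<open>Removing the top row\<close>

text \<open>A set, so that coinciding choices are counted once. It is empty for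
  \<open>p = []\<close>, which is why the recurrence for the vertex count assumes
  \<open>p \<noteq> []\<close>.\<close>

definition parent_rows :: "int list \<Rightarrow> int list set" where
  "parent_rows p = {q. Suc (length q) = length p \<and> (\<forall>j < length q. q ! j = p ! j \<or> q ! j = p ! Suc j)}"

lemma parent_rows_singleton: "parent_rows [x] = {[]}"
  by (auto simp: parent_rows_def)

lemma parent_rows_Cons_Cons:
  "parent_rows (x # y # r) = (#) x ` parent_rows (y # r) \<union> (#) y ` parent_rows (y # r)"
proof -
  have "q \<in> parent_rows (x # y # r) \<longleftrightarrow> (\<exists>a q'. q = a # q' \<and> (a = x \<or> a = y) \<and> q' \<in> parent_rows (y # r))" for q
  proof (cases q)
    case (Cons a q')
    then show ?thesis
      by (auto simp: parent_rows_def All_less_Suc2)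
  qed (simp add: parent_rows_def)
  then show ?thesis by (auto simp: set_eq_iff)
qed

lemma finite_parent_rows: "finite (parent_rows p)"
proof (induction p rule: induct_list012)
  case 1
  show ?case by (simp add: parent_rows_def)
qed (simp_all add: parent_rows_singleton parent_rows_Cons_Cons)

text \<open>Interlacing: \<open>p ! Suc i\<close> lies between \<open>q ! i\<close> and
  \<open>q ! Suc i\<close>.\<close>

lemma sorted_parent_row:
  assumes p: "sorted p" and q: "q \<in> parent_rows p"
  shows "sorted q"
proof (subst sorted_iff_nth_Suc, intro allI impI)
  fix i
  assume i: "Suc i < length q"
  have "q ! i \<le> p ! Suc i"
    using q i sorted_nth_mono[OF p, of i "Suc i"] unfolding parent_rows_def
    by (auto dest: spec[of _ i])
  also have "\<dots> \<le> q ! Suc i"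
    using q i sorted_nth_mono[OF p, of "Suc i" "Suc (Suc i)"] unfolding parent_rows_def
    by (auto dest: spec[of _ "Suc i"])
  finally show "q ! i \<le> q ! Suc i" .
qed

text \<open>Row 0 of a pattern is not stored. Placing a partition above \<open>w\<close> therefore
  means shifting \<open>w\<close> down by one row and storing \<open>q\<close> as row 1; the result
  is the same for every partition placed above.\<close>

definition add_top_row :: "int list \<Rightarrow> (nat \<times> nat \<Rightarrow>\<^sub>0 real) \<Rightarrow> (nat \<times> nat \<Rightarrow>\<^sub>0 real)" where
  "add_top_row q w = poly_mapping_on (gz_index (Suc (length q))) (\<lambda>(i, j). gz_entry q w (i - 1) j)"

lemma gz_entry_add_top_row:
  assumes "1 \<le> j" "i + j \<le> length q"
  shows "gz_entry p (add_top_row q w) (Suc i) j = gz_entry q w i j"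
  using assms
  by (simp add: gz_entry_def[of p] add_top_row_def lookup_poly_mapping_on[OF finite_gz_index] mem_gz_index_iff)

text \<open>Row 1 satisfies the conditions because \<open>q\<close> chooses between neighbours in
  the sorted list \<open>p\<close>; the lower rows inherit them from \<open>w\<close>.\<close>

lemma add_top_row_tight:
  assumes p: "sorted p" and q: "q \<in> parent_rows p" and w: "w \<in> tight_patterns q"
  shows "add_top_row q w \<in> tight_patterns p"
proof -
  let ?u = "add_top_row q w"
  have len: "length p = Suc (length q)"
    using q by (simp add: parent_rows_def)
  have *: "gz_entry p ?u i j \<le> gz_entry p ?u (Suc i) j \<and> gz_entry p ?u (Suc i) j \<le> gz_entry p ?u i (Suc j) \<and>
      (gz_entry p ?u (Suc i) j = gz_entry p ?u i j \<or> gz_entry p ?u (Suc i) j = gz_entry p ?u i (Suc j))"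
    if ij: "1 \<le> j" "Suc i + j \<le> length p" for i j
  proof (cases i)
    case 0
    have "gz_entry p ?u (Suc i) j = real_of_int (q ! (j - 1))"
      using ij len gz_entry_add_top_row[of j 0 q p w] by (simp add: 0 gz_entry_def[of q])
    moreover have "gz_entry p ?u i j = real_of_int (p ! (j - 1))" "gz_entry p ?u i (Suc j) = real_of_int (p ! j)"
      by (simp_all add: gz_entry_def 0)
    moreover have "q ! (j - 1) = p ! (j - 1) \<or> q ! (j - 1) = p ! Suc (j - 1)"
      using q ij len unfolding parent_rows_def by (auto dest!: spec[of _ "j - Suc 0"])
    moreover have "p ! (j - 1) \<le> p ! j"
      using ij by (intro sorted_nth_mono[OF p]) auto
    ultimately show ?thesis
      using ij by auto
  next
    case (Suc i')
    then show ?thesis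
      using w ij len by (simp add: gz_entry_add_top_row tight_patterns_def GZ_iff)
  qed
  have "Poly_Mapping.keys ?u \<subseteq> gz_index (length p)"
    unfolding add_top_row_def len by (rule keys_poly_mapping_on[OF finite_gz_index])
  then show ?thesis
    using * by (simp add: tight_patterns_def GZ_iff)
qed

text \<open>Row 1 determines \<open>q\<close>, and the rows below it determine
  \<open>w\<close>.\<close>

lemma add_top_row_inj:
  assumes q: "q \<in> parent_rows p" "q' \<in> parent_rows p"
    and w: "w \<in> GZ q" "w' \<in> GZ q'"
    and eq: "add_top_row q w = add_top_row q' w'"
  shows "q = q' \<and> w = w'"
proof
  have len: "length q = length q'"
    using q by (simp add: parent_rows_def)
  have entry: "gz_entry q w i j = gz_entry q' w' i j" if "1 \<le> j" "i + j \<le> length q" for i j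
    \<comment> \<open>\<open>[]\<close> is a placeholder for row 0: entries of row 1 and below are
      read from the stored function.\<close>
    using gz_entry_add_top_row[of j i q "[]" w] gz_entry_add_top_row[of j i q' "[]" w'] that eq len by simp
  show "q = q'"
  proof (rule nth_equalityI[OF len])
    fix j assume "j < length q"
    then show "q ! j = q' ! j"
      using entry[of "Suc j" 0] by (simp add: gz_entry_def)
  qed
  show "w = w'"
  proof (rule poly_mapping_eqI)
    fix x :: "nat \<times> nat"
    obtain i j where x: "x = (i, j)" by fastforce
    show "Poly_Mapping.lookup w x = Poly_Mapping.lookup w' x"
    proof (cases "(i, j) \<in> gz_index (length q)")
      case True
      then show ?thesis
        using entry[of j i] by (auto simp: x gz_entry_def mem_gz_index_iff split: if_splits)
    next
      case False
      then show ?thesis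
        using GZ_outside[OF w(1)] GZ_outside[OF w(2)] len by (simp add: x)
    qed
  qed
qed

lemma tight_pattern_cases:
  assumes v: "v \<in> tight_patterns p" and "p \<noteq> []"
  obtains q w where "q \<in> parent_rows p" "w \<in> tight_patterns q" "v = add_top_row q w"
proof
  \<comment> \<open>Tightness makes the entries of row 1 parts of \<open>p\<close>, hence integers,
    so the floor loses nothing.\<close>
  define q where "q = map (\<lambda>j. \<lfloor>Poly_Mapping.lookup v (1, Suc j)\<rfloor>) [0..<length p - 1]"
  define w where "w = poly_mapping_on (gz_index (length q)) (\<lambda>(i, j). Poly_Mapping.lookup v (Suc i, j))"
  have len: "length p = Suc (length q)"
    using \<open>p \<noteq> []\<close> by (simp add: q_def)
  have top: "(q ! j = p ! j \<or> q ! j = p ! Suc j) \<and> Poly_Mapping.lookup v (1, Suc j) = real_of_int (q ! j)"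
    if "j < length q" for j
  proof -
    have "gz_entry p v (Suc 0) (Suc j) = gz_entry p v 0 (Suc j) \<or>
        gz_entry p v (Suc 0) (Suc j) = gz_entry p v 0 (Suc (Suc j))"
      using v that len by (simp add: tight_patterns_def)
    then show ?thesis
      using that by (auto simp: gz_entry_def q_def)
  qed
  have entry: "gz_entry q w i j = gz_entry p v (Suc i) j" if "1 \<le> j" "i + j \<le> length q" for i j
    using that top[of "j - 1"]
    by (cases i) (auto simp: gz_entry_def w_def lookup_poly_mapping_on[OF finite_gz_index] mem_gz_index_iff)
  show "q \<in> parent_rows p"
    using top len by (simp add: parent_rows_def)
  have "Poly_Mapping.keys w \<subseteq> gz_index (length q)"
    unfolding w_def by (rule keys_poly_mapping_on[OF finite_gz_index])
  then show "w \<in> tight_patterns q"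
    using v len by (simp add: tight_patterns_def GZ_iff entry)
  show "v = add_top_row q w"
  proof (rule poly_mapping_eqI)
    fix x :: "nat \<times> nat"
    obtain i j where x: "x = (i, j)" by fastforce
    show "Poly_Mapping.lookup v x = Poly_Mapping.lookup (add_top_row q w) x"
    proof (cases "(i, j) \<in> gz_index (length p)")
      case True
      then have "gz_entry q w (i - 1) j = gz_entry p v i j"
        using entry[of j "i - 1"] len by (auto simp: mem_gz_index_iff)
      then show ?thesis
        using True len
        by (auto simp: x add_top_row_def lookup_poly_mapping_on[OF finite_gz_index] gz_entry_def[of p] mem_gz_index_iff)
    next
      case False
      then show ?thesis
        using GZ_outside[of v p] v
        by (simp add: x add_top_row_def lookup_poly_mapping_on[OF finite_gz_index] tight_patterns_def flip: len)
    qed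
  qed
qed

lemma bij_betw_add_top_row:
  assumes p: "sorted p" "p \<noteq> []"
  shows "bij_betw (\<lambda>(q, w). add_top_row q w) (Sigma (parent_rows p) tight_patterns) (tight_patterns p)"
  unfolding bij_betw_def
proof
  show "inj_on (\<lambda>(q, w). add_top_row q w) (Sigma (parent_rows p) tight_patterns)"
  proof (rule inj_onI, clarify)
    fix q w q' w'
    assume "q \<in> parent_rows p" "w \<in> tight_patterns q" "q' \<in> parent_rows p" "w' \<in> tight_patterns q'"
      and "add_top_row q w = add_top_row q' w'"
    then show "q = q' \<and> w = w'"
      by (intro add_top_row_inj) (auto simp: tight_patterns_def)
  qed
  show "(\<lambda>(q, w). add_top_row q w) ` Sigma (parent_rows p) tight_patterns = tight_patterns p"
  proof (intro equalityI subsetI)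
    fix v
    assume "v \<in> tight_patterns p"
    from this p(2) obtain q w where "q \<in> parent_rows p" "w \<in> tight_patterns q" "v = add_top_row q w"
      by (rule tight_pattern_cases)
    then show "v \<in> (\<lambda>(q, w). add_top_row q w) ` Sigma (parent_rows p) tight_patterns"
      by force
  qed (auto intro: add_top_row_tight[OF p(1)])
qed

lemma tight_patterns_Nil: "tight_patterns [] = {0}"
proof -
  have "gz_index 0 = {}"
    by (auto simp: gz_index_def)
  then show ?thesis
    by (auto simp: tight_patterns_def GZ_iff)
qed

text \<open>Lets \<open>card\<close> be summed over the fibres of the bijection, which also reduces
  finiteness to shorter partitions.\<close>

lemma finite_tight_patterns: "sorted p \<Longrightarrow> finite (tight_patterns p)"
proof (induction "length p" arbitrary: p)
  case 0
  then show ?case by (simp add: tight_patterns_Nil)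
next
  case (Suc n)
  then have "finite (Sigma (parent_rows p) tight_patterns)"
    using sorted_parent_row by (intro finite_SigmaI finite_parent_rows) (auto simp: parent_rows_def)
  moreover have "p \<noteq> []" using Suc.hyps by auto
  ultimately show ?case
    using bij_betw_finite[OF bij_betw_add_top_row[of p]] Suc.prems by simp
qed

lemma gz_vertex_count_Nil: "gz_vertex_count [] = 1"
  by (simp add: gz_vertex_count_eq tight_patterns_Nil)

lemma gz_vertex_count_rec:
  assumes "sorted p" "p \<noteq> []"
  shows "gz_vertex_count p = (\<Sum>q\<in>parent_rows p. gz_vertex_count q)"
proof -
  have "card (tight_patterns p) = card (Sigma (parent_rows p) tight_patterns)"
    using bij_betw_same_card[OF bij_betw_add_top_row[OF assms]] by simp
  also have "\<dots> = (\<Sum>q\<in>parent_rows p. card (tight_patterns q))"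
    using assms sorted_parent_row finite_tight_patterns
    by (intro card_SigmaI finite_parent_rows) blast
  finally show ?thesis
    by (simp add: gz_vertex_count_eq)
qed

section \<open>First rows below sequences of constant blocks\<close>

lemma sum_parent_rows_replicate:
  "sum F (parent_rows (replicate (Suc k) x)) = (F (replicate k x) :: 'a::comm_monoid_add)"
proof -
  have "parent_rows (replicate (Suc k) x) = {replicate k x}"
    by (induction k) (simp_all add: parent_rows_singleton parent_rows_Cons_Cons)
  then show ?thesis by simp
qed

text \<open>Inside the block of \<open>x\<close> there is no choice; below its last entry stands
  \<open>x\<close> or \<open>y\<close>, and the remaining entries form a first row for the rest of
  the sequence.\<close>

lemma sum_parent_rows_blocks:
  fixes F :: "int list \<Rightarrow> 'a::comm_monoid_add"
  assumes "x \<noteq> y"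
  shows "sum F (parent_rows (replicate (Suc k) x @ replicate (Suc l) y @ r)) =
    (\<Sum>q\<in>parent_rows (replicate (Suc l) y @ r). F (replicate (Suc k) x @ q)) +
    (\<Sum>q\<in>parent_rows (replicate (Suc l) y @ r). F (replicate k x @ y # q))"
proof -
  let ?A = "parent_rows (replicate (Suc l) y @ r)"
  have "parent_rows (replicate (Suc k) x @ replicate (Suc l) y @ r) =
      (\<lambda>q. replicate (Suc k) x @ q) ` ?A \<union> (\<lambda>q. replicate k x @ y # q) ` ?A"
    by (induction k) (simp_all add: parent_rows_Cons_Cons image_Un image_image)
  \<comment> \<open>Position \<open>k\<close> holds \<open>x\<close> in the one family and
    \<open>y\<close> in the other.\<close>
  moreover have "(\<lambda>q. replicate (Suc k) x @ q) ` ?A \<inter> (\<lambda>q. replicate k x @ y # q) ` ?A = {}"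
    using assms by (auto simp flip: replicate_append_same)
  ultimately show ?thesis
    by (simp add: sum.union_disjoint finite_parent_rows sum.reindex inj_on_def)
qed

lemma sum_parent_rows_two_blocks:
  fixes F :: "int list \<Rightarrow> 'a::comm_monoid_add"
  assumes "x \<noteq> y"
  shows "sum F (parent_rows (replicate (Suc k) x @ replicate (Suc l) y)) =
    F (replicate (Suc k) x @ replicate l y) + F (replicate k x @ replicate (Suc l) y)"
  using sum_parent_rows_blocks[OF assms, of F k l "[]"]
  unfolding append_Nil2 sum_parent_rows_replicate by simp

text \<open>The choices at the two block boundaries are independent: each outer block is kept or
  loses one entry, matching the four terms of \<open>(1 + x)(1 + z)\<close>.\<close>

lemma sum_parent_rows_three_blocks:
  fixes F :: "int list \<Rightarrow> 'a::comm_monoid_add"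
  assumes "x \<noteq> y" "y \<noteq> z"
  shows "sum F (parent_rows (replicate (Suc k) x @ replicate (Suc l) y @ replicate (Suc m) z)) =
    F (replicate (Suc k) x @ replicate (Suc l) y @ replicate m z) +
    F (replicate (Suc k) x @ replicate l y @ replicate (Suc m) z) +
    F (replicate k x @ replicate (Suc (Suc l)) y @ replicate m z) +
    F (replicate k x @ replicate (Suc l) y @ replicate (Suc m) z)"
  unfolding sum_parent_rows_blocks[OF assms(1)] sum_parent_rows_two_blocks[OF assms(2)]
  by (simp add: add.assoc)

subsection \<open>Coefficients\<close>

text \<open>Integer indices make multiplication by a variable an index shift without boundary cases.\<close>

definition coeff_int :: "int poly poly \<Rightarrow> int \<Rightarrow> int \<Rightarrow> int" where
  "coeff_int P a b = (if a < 0 \<or> b < 0 then 0 else coeff_xz P (nat a) (nat b))"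

lemma coeff_int_of_nat: "coeff_int P (int a) (int b) = coeff_xz P a b"
  by (simp add: coeff_int_def)

lemma coeff_int_neg: "a < 0 \<or> b < 0 \<Longrightarrow> coeff_int P a b = 0"
  by (simp add: coeff_int_def)

lemma coeff_int_0: "coeff_int 0 a b = 0"
  by (simp add: coeff_int_def coeff_xz_def)

lemma coeff_int_1: "coeff_int 1 a b = (if a = 0 \<and> b = 0 then 1 else 0)"
  using coeff_xz_monomial[of 0 0 "nat a" "nat b"] by (auto simp: coeff_int_def)

lemma coeff_int_add: "coeff_int (P + Q) a b = coeff_int P a b + coeff_int Q a b"
  by (simp add: coeff_int_def coeff_xz_def)

lemma coeff_int_diff: "coeff_int (P - Q) a b = coeff_int P a b - coeff_int Q a b"
  by (simp add: coeff_int_def coeff_xz_def)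

lemma coeff_int_x: "coeff_int (poly_x * P) a b = coeff_int P (a - 1) b"
  by (auto simp: coeff_int_def coeff_xz_def poly_x_def coeff_pCons nat_diff_distrib split: nat.split)

lemma coeff_int_z: "coeff_int (poly_z * P) a b = coeff_int P a (b - 1)"
  by (auto simp: coeff_int_def coeff_xz_def poly_z_def coeff_pCons nat_diff_distrib split: nat.split)

section \<open>Coefficients of the powers of x + z\<close>

lemma coeff_int_power_Suc:
  "coeff_int ((poly_x + poly_z) ^ Suc n) a b =
   coeff_int ((poly_x + poly_z) ^ n) (a - 1) b + coeff_int ((poly_x + poly_z) ^ n) a (b - 1)"
  by (simp add: distrib_right coeff_int_add coeff_int_x coeff_int_z)

lemma coeff_int_power_nonhomogeneous:
  "a + b \<noteq> int n \<Longrightarrow> coeff_int ((poly_x + poly_z) ^ n) a b = 0"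
proof (induction n arbitrary: a b)
  case (Suc n)
  then show ?case
    using Suc.IH[of "a - 1" b] Suc.IH[of a "b - 1"] by (simp del: power_Suc add: coeff_int_power_Suc)
qed (simp add: coeff_int_1)

lemma coeff_int_power_commute:
  "coeff_int ((poly_x + poly_z) ^ n) a b = coeff_int ((poly_x + poly_z) ^ n) b a"
proof (induction n arbitrary: a b)
  case (Suc n)
  then show ?case
    using Suc.IH[of "a - 1" b] Suc.IH[of a "b - 1"] by (simp del: power_Suc add: coeff_int_power_Suc)
qed (simp add: coeff_int_1)

text \<open>On the antidiagonal \<open>a + b = n\<close> the reflection exchanges \<open>a\<close>
  and \<open>b\<close>; off it both coefficients vanish by homogeneity.\<close>

lemma coeff_int_power_reflect:
  "coeff_int ((poly_x + poly_z) ^ n) (int n - a) (int n - b) = coeff_int ((poly_x + poly_z) ^ n) a b"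
proof (cases "a + b = int n")
  case True
  then have "int n - a = b" "int n - b = a" by auto
  then show ?thesis using coeff_int_power_commute by metis
qed (simp add: coeff_int_power_nonhomogeneous)

section \<open>Recurrence and symmetries of the generating polynomials\<close>

lemma gz_poly_0: "gz_poly 0 = 0"
  by (simp add: gz_poly_def)

text \<open>With \<open>A = (1 + x)(1 + z)\<close> and \<open>B = x + z\<close>, one has
  \<open>A^(n+1) - B^(n+1) = A (A^n - B^n) + (A - B) B^n\<close>, and \<open>A - B = 1 + x z\<close>
  cancels the denominator.\<close>

lemma gz_poly_Suc:
  "gz_poly (Suc n) = (1 + poly_x) * (1 + poly_z) * gz_poly n + (1 - poly_x * poly_z) * (poly_x + poly_z) ^ n"
  (is "_ = ?R")
proof -
  let ?A = "(1 + poly_x) * (1 + poly_z)" and ?B = "poly_x + poly_z" and ?c = "1 + poly_x * poly_z"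
  have "?c * ?R = ?A * (?c * gz_poly n) + ?c * (1 - poly_x * poly_z) * ?B ^ n"
    by (simp add: algebra_simps)
  also have "\<dots> = (1 - poly_x * poly_z) * (?A * (1 + poly_x) ^ n * (1 + poly_z) ^ n - (?A - ?c) * ?B ^ n)"
    unfolding gz_poly_exact by (simp add: algebra_simps)
  also have "?A - ?c = ?B"
    by (simp add: algebra_simps)
  also have "(1 - poly_x * poly_z) * (?A * (1 + poly_x) ^ n * (1 + poly_z) ^ n - ?B * ?B ^ n) = ?c * gz_poly (Suc n)"
    unfolding gz_poly_exact by (simp add: mult_ac)
  finally show ?thesis
    using one_plus_xz_nonzero by simp
qed

lemma coeff_int_gz_poly_Suc:
  "coeff_int (gz_poly (Suc n)) a b =
   coeff_int (gz_poly n) a b + coeff_int (gz_poly n) (a - 1) b +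
   coeff_int (gz_poly n) a (b - 1) + coeff_int (gz_poly n) (a - 1) (b - 1) +
   coeff_int ((poly_x + poly_z) ^ n) a b - coeff_int ((poly_x + poly_z) ^ n) (a - 1) (b - 1)"
proof -
  have "gz_poly (Suc n) = gz_poly n + poly_x * gz_poly n + poly_z * gz_poly n + poly_x * (poly_z * gz_poly n)
      + (poly_x + poly_z) ^ n - poly_x * (poly_z * (poly_x + poly_z) ^ n)"
    unfolding gz_poly_Suc by (simp add: distrib_left distrib_right left_diff_distrib mult.assoc del: power_Suc)
  then show ?thesis
    by (simp only: coeff_int_add coeff_int_diff coeff_int_x coeff_int_z)
qed

lemma coeff_int_gz_poly_commute: "coeff_int (gz_poly n) a b = coeff_int (gz_poly n) b a"
proof (induction n arbitrary: a b)
  case (Suc n)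
  show ?case
    unfolding coeff_int_gz_poly_Suc
    using Suc.IH[of a b] Suc.IH[of "a - 1" b] Suc.IH[of a "b - 1"] Suc.IH[of "a - 1" "b - 1"]
      coeff_int_power_commute[of n a b] coeff_int_power_commute[of n "a - 1" "b - 1"]
    by simp
qed (simp add: gz_poly_0 coeff_int_0)

text \<open>The substitution \<open>(x, z) \<mapsto> (1/x, 1/z)\<close> changes the sign of \<open>(1 - x z) / (1 + x z)\<close>.\<close>

lemma coeff_int_gz_poly_reflect:
  "coeff_int (gz_poly n) (int n - a) (int n - b) = - coeff_int (gz_poly n) a b"
proof (induction n arbitrary: a b)
  case (Suc n)
  \<comment> \<open>Under reflection, unshifted and shifted indices trade places: the four
    \<open>gz_poly n\<close> terms are permuted with a change of sign, and the two power terms are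
    exchanged, so their difference changes sign.\<close>
  have shift: "int (Suc n) - c = int n - (c - 1)" "int n - (c - 1) - 1 = int n - c" for c
    by auto
  show ?case
    unfolding coeff_int_gz_poly_Suc shift Suc.IH coeff_int_power_reflect by simp
qed (simp add: gz_poly_0 coeff_int_0)

text \<open>Here the reflection is the swap of the two indices, so symmetry and antisymmetry
  together force zero.\<close>

lemma coeff_int_gz_poly_antidiagonal:
  assumes "a + b = int n"
  shows "coeff_int (gz_poly n) a b = 0"
proof -
  have "int n - a = b" "int n - b = a" using assms by auto
  then have "coeff_int (gz_poly n) b a = - coeff_int (gz_poly n) a b"
    using coeff_int_gz_poly_reflect by metis
  then show ?thesis
    using coeff_int_gz_poly_commute[of n a b] by simp
qed

text \<open>The second summand vanishes unless \<open>l = 0\<close>; with it the formula also holds in the degenerate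
  cases that the recurrence runs into.\<close>

lemma gz_vertex_count_partition123:
  "int (gz_vertex_count (partition123 k l m)) =
     coeff_int (gz_poly (k + l + m)) (int k) (int m) + coeff_int ((poly_x + poly_z) ^ (k + l + m)) (int k) (int m)"
proof (induction "k + l + m" arbitrary: k l m)
  \<comment> \<open>The single vertex for the empty sequence comes from the second summand,
    \<open>(x + z)^0 = 1\<close>.\<close>
  case 0
  then show ?case
    by (simp add: partition123_def gz_vertex_count_Nil gz_poly_0 coeff_int_0 coeff_int_1)
next
  case (Suc n)
  let ?V = "\<lambda>k l m. gz_vertex_count (partition123 k l m)"
  let ?g = "\<lambda>n a b. coeff_int (gz_poly n) a b" and ?b = "\<lambda>n a b. coeff_int ((poly_x + poly_z) ^ n) a b"
  have IH: "int (?V k' l' m') = ?g n (int k') (int m') + ?b n (int k') (int m')" if "k' + l' + m' = n" for k' l' m'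
    using Suc.hyps(1)[of k' l' m'] that by simp
  have rec: "?V k l m = (\<Sum>q\<in>parent_rows (partition123 k l m). gz_vertex_count q)"
    using Suc.hyps(2) sorted_partition123 by (intro gz_vertex_count_rec) (auto simp: partition123_def)
  \<comment> \<open>The values 1 and 3 become adjacent when \<open>l = 0\<close>.\<close>
  have distinct: "(1::int) \<noteq> 2" "(2::int) \<noteq> 3" "(1::int) \<noteq> 3"
    by simp_all
  note blocks = partition123_def replicate_0 append_Nil append_Nil2 sum_parent_rows_replicate
    distinct[THEN sum_parent_rows_two_blocks] sum_parent_rows_three_blocks[OF distinct(1,2)]
  \<comment> \<open>These remove the terms of absent outer blocks, the powers off the antidiagonal,
    and \<open>gz_poly\<close> on it.\<close>
  note zero = coeff_int_neg coeff_int_power_nonhomogeneous coeff_int_gz_poly_antidiagonal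
  have "int (?V k l m) = ?g (Suc n) (int k) (int m) + ?b (Suc n) (int k) (int m)"
  proof (cases k; cases l; cases m)
    assume "k = 0" "l = 0" "m = 0"
    with Suc.hyps(2) show ?thesis by simp
  next
    \<comment> \<open>Whenever \<open>l = 0\<close>, the index lies on the antidiagonal:
      \<open>gz_poly\<close> contributes nothing for \<open>n\<close> or \<open>Suc n\<close>, and
      Pascal's rule for the powers of \<open>x + z\<close> remains.\<close>
    fix m' assume eq: "k = 0" "l = 0" "m = Suc m'"
    have "?V k l m = ?V 0 0 m'"
      unfolding rec unfolding eq blocks by (rule refl)
    then show ?thesis
      unfolding coeff_int_power_Suc
      using Suc.hyps(2) IH[of 0 0 m'] eq by (simp add: zero del: power_Suc)
  next
    fix l' assume eq: "k = 0" "l = Suc l'" "m = 0"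
    have "?V k l m = ?V 0 l' 0"
      unfolding rec unfolding eq blocks by (rule refl)
    then show ?thesis
      unfolding coeff_int_gz_poly_Suc coeff_int_power_Suc
      using Suc.hyps(2) IH[of 0 l' 0] eq by (simp add: zero del: power_Suc)
  next
    fix l' m' assume eq: "k = 0" "l = Suc l'" "m = Suc m'"
    have "?V k l m = ?V 0 (Suc l') m' + ?V 0 l' (Suc m')"
      unfolding rec unfolding eq blocks by (rule refl)
    then show ?thesis
      unfolding coeff_int_gz_poly_Suc coeff_int_power_Suc
      using Suc.hyps(2) IH[of 0 "Suc l'" m'] IH[of 0 l' "Suc m'"] eq by (simp add: zero del: power_Suc)
  next
    fix k' assume eq: "k = Suc k'" "l = 0" "m = 0"
    have "?V k l m = ?V k' 0 0"
      unfolding rec unfolding eq blocks by (rule refl)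
    then show ?thesis
      unfolding coeff_int_power_Suc
      using Suc.hyps(2) IH[of k' 0 0] eq by (simp add: zero del: power_Suc)
  next
    fix k' m' assume eq: "k = Suc k'" "l = 0" "m = Suc m'"
    have "?V k l m = ?V (Suc k') 0 m' + ?V k' 0 (Suc m')"
      unfolding rec unfolding eq blocks by (rule refl)
    then show ?thesis
      unfolding coeff_int_power_Suc
      using Suc.hyps(2) IH[of "Suc k'" 0 m'] IH[of k' 0 "Suc m'"] eq by (simp add: zero del: power_Suc)
  next
    fix k' l' assume eq: "k = Suc k'" "l = Suc l'" "m = 0"
    have "?V k l m = ?V (Suc k') l' 0 + ?V k' (Suc l') 0"
      unfolding rec unfolding eq blocks by (rule refl)
    then show ?thesis
      unfolding coeff_int_gz_poly_Suc coeff_int_power_Suc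
      using Suc.hyps(2) IH[of "Suc k'" l' 0] IH[of k' "Suc l'" 0] eq by (simp add: zero del: power_Suc)
  next
    \<comment> \<open>The added power term at \<open>(k, m)\<close> can be nonzero only for
      \<open>l' = 0\<close>, where it is the count for \<open>?V (Suc k') 0 (Suc m')\<close>. The
      subtracted one at \<open>(k - 1, m - 1)\<close> vanishes because its index sum is below
      \<open>n\<close>.\<close>
    fix k' l' m' assume eq: "k = Suc k'" "l = Suc l'" "m = Suc m'"
    have "?V k l m = ?V (Suc k') (Suc l') m' + ?V (Suc k') l' (Suc m') +
        ?V k' (Suc (Suc l')) m' + ?V k' (Suc l') (Suc m')"
      unfolding rec unfolding eq blocks by (rule refl)
    then show ?thesis
      unfolding coeff_int_gz_poly_Suc coeff_int_power_Suc
      using Suc.hyps(2) IH[of "Suc k'" "Suc l'" m'] IH[of "Suc k'" l' "Suc m'"]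
        IH[of k' "Suc (Suc l')" m'] IH[of k' "Suc l'" "Suc m'"] eq
      by (simp add: zero del: power_Suc)
  qed
  then show ?case
    unfolding Suc.hyps(2) .
qed

theorem theorem1p4:
  fixes k l m :: nat
  assumes "k > 0" and "l > 0" and "m > 0"
  shows "int (gz_vertex_count (partition123 k l m)) =
         coeff_xz (gz_poly (k + l + m)) k m"
  \<comment> \<open>As \<open>l > 0\<close>, the index sum \<open>k + m\<close> is smaller than the
    exponent, so the second summand vanishes.\<close>
  using assms coeff_int_power_nonhomogeneous[of "int k" "int m" "k + l + m"]
  unfolding gz_vertex_count_partition123 coeff_int_of_nat by simp

end
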